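(* There exists a normal, countably tight $T_1$ topological space $X$ such that $t(X_\delta) > 2^{\omega}$.
   Context: For a topological space $X$, the $G_\delta$-modification $X_\delta$ is the set $X$ equipped with the topology generated by all $G_\delta$-subsets of $X$. The tightness $t(X)$ is the least infinite cardinal $\kappa$ such that for every $A \subseteq X$ and every $p$ in the closure $\overline{A}$ there is $B \subseteq A$ with $|B| \le \kappa$ and $p \in \overline{B}$. $X$ is countably tight if $t(X) = \omega$. *)

theory Defs
  imports "HOL-Analysis.Analysis"
begin

unbundle cardinal_syntax

definition gdelta_modification :: "'a topology \<Rightarrow> 'a topology" where
  "gdelta_modification X = topology_generated_by {S. gdelta_in X S}"

lemma topspace_gdelta_modification [simp]:
  "topspace (gdelta_modification X) = topspace X"
proof -
  have "\<Union> {S. gdelta_in X S} = topspace X"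
    using gdelta_in_topspace gdelta_in_subset by blast
  then show ?thesis
    by (simp add: gdelta_modification_def)
qed

text \<open>Cardinals are represented by cardinal orders in the sense of the HOL theory of cardinals.\<close>

definition tight_for :: "'a topology \<Rightarrow> 'k rel \<Rightarrow> bool" where
  "tight_for X \<kappa> \<longleftrightarrow>
     (\<forall>A p. A \<subseteq> topspace X \<longrightarrow> p \<in> X closure_of A \<longrightarrow>
        (\<exists>B. B \<subseteq> A \<and> |B| \<le>o \<kappa> \<and> p \<in> X closure_of B))"

definition least_tight :: "'a topology \<Rightarrow> 'k rel \<Rightarrow> bool" where
  "least_tight X \<kappa> \<longleftrightarrow>
     Cinfinite \<kappa> \<and> tight_for X \<kappa> \<and>
     (\<forall>\<kappa>' :: 'k rel. Cinfinite \<kappa>' \<longrightarrow> tight_for X \<kappa>' \<longrightarrow> \<kappa> \<le>o \<kappa>')"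

text \<open>
  The tightness of a space with points in \<open>'a\<close> is at most the larger of \<open>\<omega>\<close> and the
  cardinality of \<open>'a\<close>, so it is represented by a cardinal order on \<open>'a + nat\<close>. The choice below
  is unique up to order isomorphism; the following lemmas show that such a cardinal order exists
  and that it is least among the infinite cardinals on all types.
\<close>

definition tightness :: "'a topology \<Rightarrow> ('a + nat) rel" where
  "tightness X = (SOME \<kappa>. least_tight X \<kappa>)"

lemma least_tight_tightness: "least_tight X (tightness X)"
proof -
  let ?R = "{\<kappa> :: ('a + nat) rel. Cinfinite \<kappa> \<and> tight_for X \<kappa>}"
  have "Cinfinite |UNIV :: ('a + nat) set|"
    using card_of_Card_order by (auto simp: cinfinite_def Field_card_of)
  moreover have "tight_for X |UNIV :: ('a + nat) set|"
  proof -
    have "|B| \<le>o |UNIV :: ('a + nat) set|" for B :: "'a set"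
      by (rule card_of_ordLeqI[of Inl]) auto
    then show ?thesis
      unfolding tight_for_def by blast
  qed
  ultimately have "?R \<noteq> {}"
    by blast
  moreover have "\<forall>\<kappa>\<in>?R. Card_order \<kappa>"
    by blast
  ultimately obtain \<kappa> where "\<kappa> \<in> ?R" "\<forall>\<kappa>'\<in>?R. \<kappa> \<le>o \<kappa>'"
    using exists_minim_Card_order[of ?R] by blast
  then have "least_tight X \<kappa>"
    by (auto simp: least_tight_def)
  then show ?thesis
    unfolding tightness_def by (rule someI)
qed

lemma tightness_least:
  fixes X :: "'a topology" and \<kappa> :: "'k rel"
  assumes \<kappa>: "Cinfinite \<kappa>" "tight_for X \<kappa>"
  shows "tightness X \<le>o \<kappa>"
proof (rule ccontr)
  assume "\<not> tightness X \<le>o \<kappa>"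
  moreover have lt: "least_tight X (tightness X)"
    by (rule least_tight_tightness)
  ultimately have less: "\<kappa> <o tightness X"
    using \<kappa>(1) not_ordLeq_iff_ordLess[of \<kappa> "tightness X"]
    by (auto simp: least_tight_def dest: card_order_on_well_order_on)
  then have "|Field \<kappa>| \<le>o |Field (tightness X)|"
    by (intro card_of_mono2) (rule ordLess_imp_ordLeq)
  then obtain f where f: "inj_on f (Field \<kappa>)" "f ` Field \<kappa> \<subseteq> Field (tightness X)"
    by (auto simp: card_of_ordLeq[symmetric])
  let ?\<mu> = "|f ` Field \<kappa>|"
  have "|Field \<kappa>| =o ?\<mu>"
    using f(1) card_of_ordIsoI inj_on_imp_bij_betw by blast
  then have iso: "\<kappa> =o ?\<mu>"
    using \<kappa>(1) card_of_Field_ordIso ordIso_symmetric ordIso_transitive by blast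
  have "Cinfinite ?\<mu>"
    using Cinfinite_cong[OF iso \<kappa>(1)] .
  moreover have "tight_for X ?\<mu>"
    using \<kappa>(2) iso unfolding tight_for_def by (meson ordLeq_ordIso_trans)
  ultimately have "tightness X \<le>o ?\<mu>"
    using lt by (auto simp: least_tight_def)
  then have "tightness X \<le>o \<kappa>"
    using iso ordIso_symmetric ordLeq_ordIso_trans by blast
  then show False
    using less not_ordLess_ordLeq by blast
qed

definition countably_tight :: "'a topology \<Rightarrow> bool" where
  "countably_tight X \<longleftrightarrow> tightness X =o natLeq"

end

theory Submission
  imports Defs "HOL-Library.Countable_Set_Type"
begin

text \<open>
  Let $E$ be a graph on $V$. Make $V \cup \{p\}$ a space in which the points of $V$ are isolated and
  the neighbourhoods of $p$ are the complements of sets of finite chromatic number. With just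
  one non-isolated point, such a space is normal; by the de Bruijn--Erd\H{o}s theorem, every set
  of infinite chromatic number has a countable subset of infinite chromatic number, so the space
  is countably tight. In the $G_\delta$-modification, $p$ lies in the closure of $B \subseteq V$
  exactly if $B$ has uncountable chromatic number. The Erd\H{o}s--Hajnal shift graph, whose
  vertices are the pairs of points of a set of size $> 2^\omega$, has uncountable chromatic
  number while each of its subgraphs of size $\le 2^\omega$ is countably chromatic.
\<close>

section \<open>Finite and countable chromatic number\<close>

text \<open>An arbitrary relation \<open>E\<close> stands for its underlying undirected graph, since
  the constraint on the colours is symmetric. A loop within \<open>A\<close> rules out every
  colouring.\<close>

definition proper_colouring :: "('v \<Rightarrow> 'v \<Rightarrow> bool) \<Rightarrow> 'v set \<Rightarrow> ('v \<Rightarrow> nat) \<Rightarrow> bool" where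
  "proper_colouring E A c \<longleftrightarrow> (\<forall>u\<in>A. \<forall>v\<in>A. E u v \<longrightarrow> c u \<noteq> c v)"

text \<open>The palette \<open>{..k}\<close> has \<open>k + 1\<close> colours and is never empty, so
  a default colour is always at hand.\<close>

definition finitely_colourable :: "('v \<Rightarrow> 'v \<Rightarrow> bool) \<Rightarrow> 'v set \<Rightarrow> bool" where
  "finitely_colourable E A \<longleftrightarrow> (\<exists>c k. proper_colouring E A c \<and> c ` A \<subseteq> {..k})"

definition countably_colourable :: "('v \<Rightarrow> 'v \<Rightarrow> bool) \<Rightarrow> 'v set \<Rightarrow> bool" where
  "countably_colourable E A \<longleftrightarrow> (\<exists>c. proper_colouring E A c)"

lemma proper_colouring_subset:
  "proper_colouring E A c \<Longrightarrow> B \<subseteq> A \<Longrightarrow> proper_colouring E B c"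
  by (auto simp: proper_colouring_def)

lemma finitely_colourable_subset:
  "finitely_colourable E A \<Longrightarrow> B \<subseteq> A \<Longrightarrow> finitely_colourable E B"
  unfolding finitely_colourable_def using proper_colouring_subset by (metis image_mono order_trans)

lemma countably_colourable_subset:
  "countably_colourable E A \<Longrightarrow> B \<subseteq> A \<Longrightarrow> countably_colourable E B"
  unfolding countably_colourable_def using proper_colouring_subset by metis

lemma finitely_colourable_empty [simp]: "finitely_colourable E {}"
  by (auto simp: finitely_colourable_def proper_colouring_def)

lemma finitely_colourable_independent:
  assumes "\<And>u v. u \<in> A \<Longrightarrow> v \<in> A \<Longrightarrow> \<not> E u v"
  shows "finitely_colourable E A"
  unfolding finitely_colourable_def proper_colouring_def
  using assms by (intro exI[of _ "\<lambda>_. 0"]) auto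

lemma finitely_colourable_Un:
  assumes "finitely_colourable E A" "finitely_colourable E B"
  shows "finitely_colourable E (A \<union> B)"
proof -
  obtain a k b l where a: "proper_colouring E A a" "a ` A \<subseteq> {..k}"
    and b: "proper_colouring E B b" "b ` B \<subseteq> {..l}"
    using assms unfolding finitely_colourable_def by blast
  \<comment> \<open>Colours on \<open>B - A\<close> are shifted past \<open>k\<close>, which makes
    the two palettes disjoint.\<close>
  let ?c = "\<lambda>u. if u \<in> A then a u else Suc (k + b u)"
  have "proper_colouring E (A \<union> B) ?c"
    unfolding proper_colouring_def
  proof (intro ballI impI)
    fix u v assume uv: "u \<in> A \<union> B" "v \<in> A \<union> B" "E u v"
    have "a w \<le> k" if "w \<in> A" for w
      using a(2) that by blast
    then have "a w \<noteq> Suc (k + m)" if "w \<in> A" for w m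
      using that by (metis not_less_eq_eq le_add1)
    moreover have "a u \<noteq> a v" if "u \<in> A" "v \<in> A"
      using a(1) uv(3) that unfolding proper_colouring_def by blast
    moreover have "b u \<noteq> b v" if "u \<notin> A" "v \<notin> A"
      using b(1) uv that unfolding proper_colouring_def by blast
    ultimately show "?c u \<noteq> ?c v"
      by (metis add_left_cancel nat.inject)
  qed
  moreover have "?c ` (A \<union> B) \<subseteq> {..Suc (k + l)}"
  proof (rule image_subsetI)
    fix u assume "u \<in> A \<union> B"
    moreover have "a u \<le> k" if "u \<in> A"
      using a(2) that by blast
    moreover have "b u \<le> l" if "u \<in> B"
      using b(2) that by blast
    ultimately show "?c u \<in> {..Suc (k + l)}"
      by (cases "u \<in> A") auto
  qed
  ultimately show ?thesis
    unfolding finitely_colourable_def by blast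
qed

text \<open>A vertex is coloured by the first piece containing it, paired with its colour there.
  Equal codes put both ends of an edge into one piece, whose colouring is proper.\<close>

lemma countably_colourable_UN:
  fixes A :: "nat \<Rightarrow> 'v set"
  assumes "\<And>n. countably_colourable E (A n)"
  shows "countably_colourable E (\<Union>n. A n)"
proof -
  obtain c where c: "\<And>n. proper_colouring E (A n) (c n)"
    using assms unfolding countably_colourable_def by metis
  define i where "i u = (LEAST n. u \<in> A n)" for u
  have i: "u \<in> A (i u)" if "u \<in> (\<Union>n. A n)" for u
    using that unfolding i_def by (auto intro: LeastI)
  have "proper_colouring E (\<Union>n. A n) (\<lambda>u. prod_encode (i u, c (i u) u))"
    unfolding proper_colouring_def
  proof (intro ballI impI notI)
    fix u v assume uv: "u \<in> (\<Union>n. A n)" "v \<in> (\<Union>n. A n)" "E u v"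
      and "prod_encode (i u, c (i u) u) = prod_encode (i v, c (i v) v)"
    then have "i u = i v" "c (i u) u = c (i u) v"
      by auto
    then show False
      using i[OF uv(1)] i[OF uv(2)] uv(3) c[of "i u"] by (auto simp: proper_colouring_def)
  qed
  then show ?thesis
    unfolding countably_colourable_def by blast
qed

lemma countably_colourable_Un:
  assumes "countably_colourable E A" "countably_colourable E B"
  shows "countably_colourable E (A \<union> B)"
proof -
  have "countably_colourable E (\<Union>n::nat. if n = 0 then A else B)"
    by (rule countably_colourable_UN) (use assms in auto)
  moreover have "A \<union> B \<subseteq> (\<Union>n::nat. if n = 0 then A else B)"
    by (auto split: if_splits intro: exI[of _ "1::nat"])
  ultimately show ?thesis
    by (rule countably_colourable_subset)
qed

lemma finitely_imp_countably_colourable: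
  "finitely_colourable E A \<Longrightarrow> countably_colourable E A"
  by (auto simp: finitely_colourable_def countably_colourable_def)

section \<open>Compactness of finite colourings\<close>

text \<open>By Tychonoff, the space \<open>T\<close> of all maps from \<open>A\<close> to
  \<open>{..k}\<close> is compact. If no map is proper, the open sets of maps that fail at a given
  edge cover \<open>T\<close>. A finite subcover names finitely many edges, and a proper colouring
  of their ends extends to a map outside all its members.\<close>

lemma de_Bruijn_Erdos:
  assumes fin: "\<And>F. finite F \<Longrightarrow> F \<subseteq> A \<Longrightarrow> \<exists>c. proper_colouring E F c \<and> c ` F \<subseteq> {..k}"
  shows "\<exists>c. proper_colouring E A c \<and> c ` A \<subseteq> {..k}"
proof (rule ccontr)
  assume no: "\<nexists>c. proper_colouring E A c \<and> c ` A \<subseteq> {..k}"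
  define T where "T = product_topology (\<lambda>_. discrete_topology {..k}) A"
  define M where "M = (\<lambda>(u, v). {f \<in> topspace T. f u = f v})"
  define P where "P = {(u, v). u \<in> A \<and> v \<in> A \<and> E u v}"
  have topT: "topspace T = (\<Pi>\<^sub>E i\<in>A. {..k})"
    by (simp add: T_def)
  have "compact_space T"
    unfolding T_def by (simp add: compact_space_product_topology compact_space_discrete_topology)
  moreover have "openin T U" if U: "U \<in> M ` P" for U
  proof -
    obtain u v where uv: "u \<in> A" "v \<in> A" "U = M (u, v)"
      using U unfolding P_def by blast
    have *: "openin T {f \<in> topspace T. f w \<in> {i} \<inter> {..k}}" if "w \<in> A" for w i
      unfolding T_def
      by (rule openin_continuous_map_preimage[OF continuous_map_product_projection[OF that]]) simp
    \<comment> \<open>Failure at an edge depends on two coordinates only: split by the common colour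
      \<open>i\<close>.\<close>
    have "U = (\<Union>i\<in>{..k}. {f \<in> topspace T. f u \<in> {i} \<inter> {..k}} \<inter> {f \<in> topspace T. f v \<in> {i} \<inter> {..k}})"
      using uv by (auto simp: M_def topT)
    also have "openin T \<dots>"
      using * uv by (intro openin_Union) blast
    finally show ?thesis .
  qed
  moreover have "topspace T \<subseteq> \<Union> (M ` P)"
  proof
    fix f assume f: "f \<in> topspace T"
    then have "f ` A \<subseteq> {..k}"
      by (auto simp: topT)
    then obtain u v where "u \<in> A" "v \<in> A" "E u v" "f u = f v"
      using no unfolding proper_colouring_def by blast
    then show "f \<in> \<Union> (M ` P)"
      using f by (auto simp: M_def P_def)
  qed
  ultimately obtain \<F> where "finite \<F>" "\<F> \<subseteq> M ` P" "topspace T \<subseteq> \<Union>\<F>"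
    unfolding compact_space_alt by meson
  then obtain Q where Q: "finite Q" "Q \<subseteq> P" "topspace T \<subseteq> \<Union> (M ` Q)"
    by (metis finite_subset_image)
  define F where "F = fst ` Q \<union> snd ` Q"
  have "finite F" "F \<subseteq> A"
    using Q by (auto simp: F_def P_def)
  then obtain c where c: "proper_colouring E F c" "c ` F \<subseteq> {..k}"
    using fin by blast
  \<comment> \<open>The default colour 0 lies in \<open>{..k}\<close>, so the extension is again a
    point of \<open>T\<close>.\<close>
  define f where "f = (\<lambda>u\<in>A. if u \<in> F then c u else 0)"
  have "f \<in> topspace T"
    using c(2) unfolding topT f_def image_subset_iff by simp
  then obtain u v where uv: "(u, v) \<in> Q" "f u = f v"
    using Q by (auto simp: M_def)
  moreover from uv(1) have "E u v" "u \<in> A" "v \<in> A"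
    using Q(2) by (auto simp: P_def)
  moreover from uv(1) have "u \<in> F" "v \<in> F"
    unfolding F_def by (metis UnI1 fst_conv image_eqI, metis UnI2 snd_conv image_eqI)
  ultimately show False
    using c(1) by (simp add: f_def proper_colouring_def)
qed

text \<open>For each \<open>k\<close>, compactness yields a finite subset that \<open>{..k}\<close>
  does not suffice to colour. The union of these subsets is countable and defeats every
  \<open>k\<close>.\<close>

lemma countable_not_finitely_colourable:
  assumes "\<not> finitely_colourable E A"
  shows "\<exists>B\<subseteq>A. countable B \<and> \<not> finitely_colourable E B"
proof -
  have "\<exists>F. finite F \<and> F \<subseteq> A \<and> (\<nexists>c. proper_colouring E F c \<and> c ` F \<subseteq> {..k})" for k
    using assms de_Bruijn_Erdos[of A E k] unfolding finitely_colourable_def by blast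
  then obtain F where F: "\<And>k. finite (F k)" "\<And>k. F k \<subseteq> A"
      "\<And>k. \<nexists>c. proper_colouring E (F k) c \<and> c ` F k \<subseteq> {..k}"
    by metis
  have "\<not> finitely_colourable E (\<Union>k. F k)"
  proof
    assume "finitely_colourable E (\<Union>k. F k)"
    then obtain c k where c: "proper_colouring E (\<Union>k. F k) c" "c ` (\<Union>k. F k) \<subseteq> {..k}"
      unfolding finitely_colourable_def by blast
    have "proper_colouring E (F k) c" "c ` F k \<subseteq> {..k}"
      using c proper_colouring_subset[OF c(1), of "F k"] by auto
    then show False
      using F(3) by blast
  qed
  moreover have "countable (\<Union>k. F k)" "(\<Union>k. F k) \<subseteq> A"
    using F by (auto intro: countable_finite)
  ultimately show ?thesis
    by blast
qed

section \<open>The space with one non-isolated point\<close>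

definition colouring_topology :: "('v \<Rightarrow> 'v \<Rightarrow> bool) \<Rightarrow> 'v \<Rightarrow> 'v set \<Rightarrow> 'v topology" where
  "colouring_topology E p V =
     topology (\<lambda>U. U \<subseteq> insert p V \<and> (p \<in> U \<longrightarrow> finitely_colourable E (V - U)))"

text \<open>The finitely colourable sets form an ideal: closure under binary unions gives
  intersections of open sets, closure under subsets gives arbitrary unions.\<close>

lemma openin_colouring_topology:
  "openin (colouring_topology E p V) U \<longleftrightarrow>
     U \<subseteq> insert p V \<and> (p \<in> U \<longrightarrow> finitely_colourable E (V - U))"
proof -
  have "istopology (\<lambda>U. U \<subseteq> insert p V \<and> (p \<in> U \<longrightarrow> finitely_colourable E (V - U)))"
    unfolding istopology_def
  proof (intro conjI allI impI)
    fix S T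
    assume S: "S \<subseteq> insert p V \<and> (p \<in> S \<longrightarrow> finitely_colourable E (V - S))"
      and T: "T \<subseteq> insert p V \<and> (p \<in> T \<longrightarrow> finitely_colourable E (V - T))"
    show "S \<inter> T \<subseteq> insert p V"
      using S by blast
    assume "p \<in> S \<inter> T"
    then show "finitely_colourable E (V - S \<inter> T)"
      using S T finitely_colourable_Un[of E "V - S" "V - T"] by (simp add: Diff_Int)
  next
    fix \<K>
    assume \<K>: "\<forall>K\<in>\<K>. K \<subseteq> insert p V \<and> (p \<in> K \<longrightarrow> finitely_colourable E (V - K))"
    show "\<Union>\<K> \<subseteq> insert p V"
      using \<K> by blast
    assume "p \<in> \<Union>\<K>"
    then obtain K where "K \<in> \<K>" "p \<in> K"
      by blast
    then show "finitely_colourable E (V - \<Union>\<K>)"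
      using \<K> finitely_colourable_subset[of E "V - K" "V - \<Union>\<K>"] by blast
  qed
  then show ?thesis
    by (simp add: colouring_topology_def)
qed

lemma topspace_colouring_topology [simp]:
  "topspace (colouring_topology E p V) = insert p V"
proof (rule subset_antisym)
  show "topspace (colouring_topology E p V) \<subseteq> insert p V"
    using openin_colouring_topology openin_topspace by metis
  have "V - insert p V = {}"
    by blast
  then have "openin (colouring_topology E p V) (insert p V)"
    unfolding openin_colouring_topology by (metis finitely_colourable_empty order_refl)
  then show "insert p V \<subseteq> topspace (colouring_topology E p V)"
    by (rule openin_subset)
qed

text \<open>A closed set that misses \<open>p\<close> is also open. Of two disjoint closed sets at
  least one misses \<open>p\<close>, and this set and its complement separate the two.\<close>

lemma normal_space_colouring_topology: "normal_space (colouring_topology E p V)"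
  unfolding normal_space_def
proof (intro allI impI)
  let ?X = "colouring_topology E p V"
  fix S T assume "closedin ?X S \<and> closedin ?X T \<and> disjnt S T"
  then have cl: "closedin ?X S" "closedin ?X T" and ST: "disjnt S T"
    by auto
  have op: "openin ?X R" if "closedin ?X R" "p \<notin> R" for R
    using closedin_subset[OF that(1)] that(2) by (simp add: openin_colouring_topology)
  show "\<exists>U W. openin ?X U \<and> openin ?X W \<and> S \<subseteq> U \<and> T \<subseteq> W \<and> disjnt U W"
  proof (cases "p \<in> S")
    case False
    have "T \<subseteq> topspace ?X - S"
      using closedin_subset[OF cl(2)] ST by (auto simp: disjnt_def)
    moreover have "openin ?X (topspace ?X - S)"
      using cl by blast
    ultimately show ?thesis
      using op[OF cl(1) False] by (intro exI[of _ S] exI[of _ "topspace ?X - S"]) (auto simp: disjnt_def)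
  next
    case True
    then have "p \<notin> T"
      using ST by (auto simp: disjnt_def)
    have "S \<subseteq> topspace ?X - T"
      using closedin_subset[OF cl(1)] ST by (auto simp: disjnt_def)
    moreover have "openin ?X (topspace ?X - T)"
      using cl by blast
    ultimately show ?thesis
      using op[OF cl(2) \<open>p \<notin> T\<close>] by (intro exI[of _ "topspace ?X - T"] exI[of _ T]) (auto simp: disjnt_def)
  qed
qed

text \<open>The complement of a point is open because a single vertex without a loop is
  independent.\<close>

lemma t1_space_colouring_topology:
  assumes "\<And>v. v \<in> V \<Longrightarrow> \<not> E v v"
  shows "t1_space (colouring_topology E p V)"
  unfolding t1_space_def
proof (intro ballI impI)
  let ?X = "colouring_topology E p V"
  fix x y assume xy: "x \<in> topspace ?X" "y \<in> topspace ?X" "x \<noteq> y"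
  have "finitely_colourable E (V - (topspace ?X - {y}))"
    by (rule finitely_colourable_independent) (use assms in auto)
  then show "\<exists>U. openin ?X U \<and> x \<in> U \<and> y \<notin> U"
    using xy by (intro exI[of _ "topspace ?X - {y}"]) (auto simp: openin_colouring_topology)
qed

text \<open>The largest candidate for a neighbourhood of \<open>p\<close> that misses
  \<open>A\<close> is \<open>insert p (V - A)\<close>, and it is open exactly if \<open>A\<close> is
  finitely colourable.\<close>

lemma closure_of_colouring_topology:
  assumes "p \<notin> V" "A \<subseteq> V"
  shows "p \<in> colouring_topology E p V closure_of A \<longleftrightarrow> \<not> finitely_colourable E A"
proof
  let ?X = "colouring_topology E p V"
  assume p: "p \<in> ?X closure_of A"
  show "\<not> finitely_colourable E A"
  proof
    assume "finitely_colourable E A"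
    moreover have "V - insert p (V - A) = A"
      using assms by blast
    ultimately have "openin ?X (insert p (V - A))"
      by (auto simp: openin_colouring_topology)
    then show False
      using p assms by (auto simp: in_closure_of)
  qed
next
  let ?X = "colouring_topology E p V"
  assume A: "\<not> finitely_colourable E A"
  have "\<exists>y. y \<in> A \<and> y \<in> U" if "p \<in> U" "openin ?X U" for U
  proof (rule ccontr)
    assume "\<nexists>y. y \<in> A \<and> y \<in> U"
    then have "A \<subseteq> V - U"
      using assms by blast
    then show False
      using A that finitely_colourable_subset by (auto simp: openin_colouring_topology)
  qed
  then show "p \<in> ?X closure_of A"
    by (auto simp: in_closure_of)
qed

text \<open>A point of \<open>A\<close> is witnessed by its singleton. Only \<open>p\<close> can be
  a limit outside \<open>A\<close>, and there a countable subset of infinite chromatic number serves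
  as \<open>B\<close>.\<close>

lemma countably_tight_colouring_topology:
  assumes "p \<notin> V"
  shows "countably_tight (colouring_topology E p V)"
proof -
  let ?X = "colouring_topology E p V"
  have "\<exists>B\<subseteq>A. countable B \<and> x \<in> ?X closure_of B" if A: "A \<subseteq> topspace ?X" "x \<in> ?X closure_of A" for A x
  proof (cases "x \<in> A")
    case True
    then show ?thesis
      using A(1) closure_of_subset[of "{x}" ?X] by (intro exI[of _ "{x}"]) auto
  next
    case False
    have "x = p"
    proof (rule ccontr)
      assume "x \<noteq> p"
      then have "openin ?X {x}"
        using A(2) by (auto simp: openin_colouring_topology in_closure_of)
      then show False
        using A(2) False by (auto simp: in_closure_of)
    qed
    then have AV: "A \<subseteq> V"
      using A(1) False by auto
    then obtain B where "B \<subseteq> A" "countable B" "\<not> finitely_colourable E B"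
      using A(2) \<open>x = p\<close> assms closure_of_colouring_topology countable_not_finitely_colourable
      by metis
    then show ?thesis
      using AV \<open>x = p\<close> assms closure_of_colouring_topology[of p V B E] by blast
  qed
  then have "tight_for ?X natLeq"
    unfolding tight_for_def countable_card_le_natLeq by blast
  then have "tightness ?X \<le>o natLeq"
    by (intro tightness_least natLeq_Cinfinite)
  \<comment> \<open>The tightness is infinite by definition.\<close>
  moreover have "natLeq \<le>o tightness ?X"
    using least_tight_tightness[of ?X] natLeq_ordLeq_cinfinite by (auto simp: least_tight_def)
  ultimately show ?thesis
    by (simp add: countably_tight_def ordIso_iff_ordLeq)
qed

section \<open>The G-delta modification at \<open>p\<close>\<close>

lemma gdelta_in_colouring_topology:
  assumes "gdelta_in (colouring_topology E p V) S" "p \<in> S"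
  shows "countably_colourable E (V - S)"
proof -
  obtain C :: "nat \<Rightarrow> _" where C: "\<And>n. openin (colouring_topology E p V) (C n)" "\<Inter> (range C) = S"
    using assms(1) unfolding gdelta_in_descending by blast
  then have "countably_colourable E (V - C n)" for n
    using assms(2) C(1)[of n] by (auto simp: openin_colouring_topology finitely_imp_countably_colourable)
  then have "countably_colourable E (\<Union>n. V - C n)"
    by (rule countably_colourable_UN)
  moreover have "V - S = (\<Union>n. V - C n)"
    using C(2) by blast
  ultimately show ?thesis
    by simp
qed

text \<open>The countably colourable sets form an ideal as well, so what holds for G-delta sets
  containing \<open>p\<close> survives the finite intersections and arbitrary unions that generate
  the topology.\<close>

lemma openin_gdelta_modification_colouring_topology:
  assumes "openin (gdelta_modification (colouring_topology E p V)) W" "p \<in> W"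
  shows "countably_colourable E (V - W)"
proof -
  have "generate_topology_on {S. gdelta_in (colouring_topology E p V) S} W"
    using assms(1) by (simp add: gdelta_modification_def openin_topology_generated_by_iff)
  then show ?thesis
    using assms(2)
  proof induction
    case Empty
    then show ?case by simp
  next
    case (Int a b)
    then show ?case
      using countably_colourable_Un[of E "V - a" "V - b"] by (simp add: Diff_Int)
  next
    case (UN K)
    then obtain k where "k \<in> K" "p \<in> k"
      by blast
    then show ?case
      using UN.IH countably_colourable_subset[of E "V - k" "V - \<Union>K"] by blast
  next
    case (Basis s)
    then show ?case
      by (simp add: gdelta_in_colouring_topology)
  qed
qed

lemma closure_of_gdelta_modification_colouring_topology:
  assumes "p \<notin> V" "A \<subseteq> V"
  shows "p \<in> gdelta_modification (colouring_topology E p V) closure_of A \<longleftrightarrow>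
           \<not> countably_colourable E A"
proof
  let ?X = "colouring_topology E p V"
  assume p: "p \<in> gdelta_modification ?X closure_of A"
  show "\<not> countably_colourable E A"
  proof
    assume "countably_colourable E A"
    then obtain c where c: "proper_colouring E A c"
      unfolding countably_colourable_def by blast
    \<comment> \<open>\<open>G n\<close> removes one colour class. The class is independent, so
      \<open>G n\<close> is open, and the intersection of all \<open>G n\<close> removes exactly
      \<open>A\<close>.\<close>
    define G where "G n = insert p (V - {u \<in> A. c u = n})" for n
    have "finitely_colourable E (V - G n)" for n
    proof (rule finitely_colourable_independent)
      fix u v assume "u \<in> V - G n" "v \<in> V - G n"
      then show "\<not> E u v"
        using c unfolding G_def proper_colouring_def by (metis (mono_tags, lifting) Diff_iff insertCI mem_Collect_eq)
    qed
    then have "gdelta_in ?X (G n)" for n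
      by (intro open_imp_gdelta_in) (auto simp: openin_colouring_topology G_def)
    then have "gdelta_in ?X (\<Inter> (range G))"
      by (intro gdelta_in_Inter) auto
    moreover have "\<Inter> (range G) = insert p (V - A)"
      using assms by (auto simp: G_def)
    ultimately have "openin (gdelta_modification ?X) (insert p (V - A))"
      unfolding gdelta_modification_def by (intro topology_generated_by_Basis) simp
    then show False
      using p assms by (auto simp: in_closure_of)
  qed
next
  let ?X = "colouring_topology E p V"
  assume A: "\<not> countably_colourable E A"
  have "\<exists>y. y \<in> A \<and> y \<in> W" if W: "p \<in> W" "openin (gdelta_modification ?X) W" for W
  proof (rule ccontr)
    assume "\<nexists>y. y \<in> A \<and> y \<in> W"
    then have "A \<subseteq> V - W"
      using assms by blast
    then show False
      using A W openin_gdelta_modification_colouring_topology countably_colourable_subset by metis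
  qed
  then show "p \<in> gdelta_modification ?X closure_of A"
    by (auto simp: in_closure_of)
qed

text \<open>The set \<open>V\<close> is the witness: in the modification \<open>p\<close> lies in
  its closure, but in the closure of no subset of size at most \<open>\<kappa>\<close>.\<close>

lemma tightness_gdelta_modification_colouring_topology:
  assumes p: "p \<notin> V" and \<kappa>: "Card_order \<kappa>"
    and V: "\<not> countably_colourable E V"
    and small: "\<And>B. B \<subseteq> V \<Longrightarrow> |B| \<le>o \<kappa> \<Longrightarrow> countably_colourable E B"
  shows "\<kappa> <o tightness (gdelta_modification (colouring_topology E p V))"
proof (rule ccontr)
  let ?Y = "gdelta_modification (colouring_topology E p V)"
  have t: "Cinfinite (tightness ?Y)" "tight_for ?Y (tightness ?Y)"
    using least_tight_tightness[of ?Y] by (auto simp: least_tight_def)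
  assume "\<not> \<kappa> <o tightness ?Y"
  then have le: "tightness ?Y \<le>o \<kappa>"
    using \<kappa> t(1) not_ordLess_iff_ordLeq by (auto dest: card_order_on_well_order_on)
  have "p \<in> ?Y closure_of V"
    using p V closure_of_gdelta_modification_colouring_topology[of p V V] by simp
  moreover have "V \<subseteq> topspace ?Y"
    by auto
  ultimately obtain B where B: "B \<subseteq> V" "|B| \<le>o tightness ?Y" "p \<in> ?Y closure_of B"
    using t(2) unfolding tight_for_def by blast
  then have "\<not> countably_colourable E B"
    using closure_of_gdelta_modification_colouring_topology[OF p B(1)] by blast
  then show False
    using small[OF B(1)] B(2) le ordLeq_transitive by blast
qed

section \<open>The shift graph\<close>

text \<open>Ordered pairs of distinct points take the place of increasing pairs in a linear order.
  The coding \<open>h\<close> moves them into the type of the points of the space; leaving out the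
  diagonal avoids loops and frees a point for \<open>p\<close>.\<close>

definition shift_vertices :: "('a \<times> 'a \<Rightarrow> 'v) \<Rightarrow> 'v set" where
  "shift_vertices h = h ` {(x, y). x \<noteq> y}"

definition shift_edge :: "('a \<times> 'a \<Rightarrow> 'v) \<Rightarrow> 'v \<Rightarrow> 'v \<Rightarrow> bool" where
  "shift_edge h u v \<longleftrightarrow> (\<exists>x y z. u = h (x, y) \<and> v = h (y, z))"

text \<open>A loop would identify \<open>(x, y)\<close> with \<open>(y, z)\<close> and so force
  \<open>x = y\<close>.\<close>

lemma shift_edge_irreflexive:
  assumes "inj h" "v \<in> shift_vertices h"
  shows "\<not> shift_edge h v v"
  using assms by (auto simp: shift_edge_def shift_vertices_def inj_eq)

text \<open>
  Associate with each point $x$ the set of colours of the pairs starting in $x$: the colour of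
  $(x, y)$ distinguishes the sets of $x$ and $y$.
\<close>
lemma shift_not_countably_colourable:
  fixes h :: "'a \<times> 'a \<Rightarrow> 'v"
  assumes "|UNIV :: nat set set| <o |UNIV :: 'a set|"
  shows "\<not> countably_colourable (shift_edge h) (shift_vertices h)"
proof
  assume "countably_colourable (shift_edge h) (shift_vertices h)"
  then obtain c where c: "proper_colouring (shift_edge h) (shift_vertices h) c"
    unfolding countably_colourable_def by blast
  define T where "T x = {c (h (x, y)) |y. y \<noteq> x}" for x
  have "inj T"
  proof (rule injI, rule ccontr)
    fix x y assume T: "T x = T y" and xy: "x \<noteq> y"
    have "c (h (x, y)) \<in> T y"
      using xy T unfolding T_def by blast
    then obtain z where z: "c (h (x, y)) = c (h (y, z))" "z \<noteq> y"
      unfolding T_def by blast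
    moreover have "shift_edge h (h (x, y)) (h (y, z))"
      unfolding shift_edge_def by blast
    moreover have "h (x, y) \<in> shift_vertices h" "h (y, z) \<in> shift_vertices h"
      using xy z by (auto simp: shift_vertices_def)
    ultimately show False
      using c unfolding proper_colouring_def by blast
  qed
  then have "|UNIV :: 'a set| \<le>o |UNIV :: nat set set|"
    by (rule card_of_ordLeqI) auto
  then show False
    using assms not_ordLess_ordLeq by blast
qed

text \<open>At most continuum many points occur in the pairs of \<open>B\<close>, so
  \<open>f\<close> can label them injectively by sets of naturals. A pair is coloured by the least
  number at which its two labels differ, together with a bit telling whether the first label
  contains it.\<close>

lemma shift_small_countably_colourable:
  fixes h :: "'a \<times> 'a \<Rightarrow> 'v"
  assumes h: "inj h" and B: "B \<subseteq> shift_vertices h" "|B| \<le>o |UNIV :: nat set set|"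
  shows "countably_colourable (shift_edge h) B"
proof -
  define s where "s u = fst (inv h u)" for u
  define t where "t u = snd (inv h u)" for u
  have "|s ` B| \<le>o |UNIV :: nat set set|" "|t ` B| \<le>o |UNIV :: nat set set|"
    using B(2) card_of_image ordLeq_transitive by blast+
  then have "|s ` B \<union> t ` B| \<le>o |UNIV :: nat set set|"
    by (intro card_of_Un_ordLeq_infinite_Field[OF _ _ _ card_of_Card_order])
      (auto simp: Field_card_of Finite_Set.finite_set)
  then obtain f :: "'a \<Rightarrow> nat set" where f: "inj_on f (s ` B \<union> t ` B)"
    by (auto simp: card_of_ordLeq[symmetric])
  define n where "n u = (LEAST n. (n \<in> f (s u)) \<noteq> (n \<in> f (t u)))" for u
  have n: "(n u \<in> f (s u)) \<noteq> (n u \<in> f (t u))" if "u \<in> B" for u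
  proof -
    have "s u \<noteq> t u"
      using that B(1) h by (auto simp: s_def t_def shift_vertices_def)
    then have "f (s u) \<noteq> f (t u)"
      using that inj_on_eq_iff[OF f, of "s u" "t u"] by simp
    then have "\<exists>n. (n \<in> f (s u)) \<noteq> (n \<in> f (t u))"
      by blast
    then show ?thesis
      unfolding n_def by (rule LeastI_ex)
  qed
  have "proper_colouring (shift_edge h) B (\<lambda>u. prod_encode (n u, of_bool (n u \<in> f (s u))))"
    unfolding proper_colouring_def
  proof (intro ballI impI notI)
    fix u v assume uv: "u \<in> B" "v \<in> B" "shift_edge h u v"
      and "prod_encode (n u, of_bool (n u \<in> f (s u))) = prod_encode (n v, of_bool (n v \<in> f (s v)))"
    then have eq: "n u = n v" "n u \<in> f (s u) \<longleftrightarrow> n v \<in> f (s v)"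
      by (auto simp: of_bool_def split: if_splits)
    \<comment> \<open>Adjacent pairs share the middle point. Equal colours would make the labels of
      \<open>s u\<close> and \<open>s v = t u\<close> agree at \<open>n u\<close>, where those of
      \<open>s u\<close> and \<open>t u\<close> differ.\<close>
    have "t u = s v"
      using uv(3) h by (auto simp: shift_edge_def s_def t_def)
    then show False
      using n[OF uv(1)] eq by auto
  qed
  then show ?thesis
    unfolding countably_colourable_def by blast
qed

section \<open>Choice of the cardinals and of the coding\<close>

theorem theorem1p3:
  shows "\<exists>X :: nat set set set topology.
           normal_space X \<and> t1_space X \<and> countably_tight X \<and>
           ctwo ^c natLeq <o tightness (gdelta_modification X)"
proof -
  \<comment> \<open>\<open>UNIV :: nat set set\<close> consists of all sets of naturals and has the
    size of the continuum; the points of the type \<open>nat set set set\<close> are two power sets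
    further up.\<close>
  have less: "|UNIV :: nat set set| <o |UNIV :: nat set set set set|"
  proof -
    have "|UNIV :: nat set set| <o |UNIV :: nat set set set|"
      using card_of_Pow[of "UNIV :: nat set set"] by simp
    also have "|UNIV :: nat set set set| <o |UNIV :: nat set set set set|"
      using card_of_Pow[of "UNIV :: nat set set set"] by simp
    finally show ?thesis .
  qed
  have "infinite (UNIV :: nat set set set set)"
    by (simp add: Finite_Set.finite_set)
  \<comment> \<open>An infinite set is equinumerous with its square, so pairs of points can be coded
    by points of the same type.\<close>
  then have "|(UNIV :: nat set set set set) \<times> (UNIV :: nat set set set set)| \<le>o |UNIV :: nat set set set set|"
    by (intro ordIso_imp_ordLeq card_of_Times_same_infinite)
  then obtain h :: "nat set set set \<times> nat set set set \<Rightarrow> nat set set set" where h: "inj h"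
    unfolding card_of_ordLeq[symmetric] UNIV_Times_UNIV by blast
  \<comment> \<open>The code of a diagonal pair is never a vertex.\<close>
  define p where "p = h ({}, {})"
  let ?V = "shift_vertices h" and ?E = "shift_edge h"
  have p: "p \<notin> ?V"
    using h by (auto simp: p_def shift_vertices_def inj_eq)
  \<comment> \<open>The cardinal power is the set of functions from the naturals to a two-element
    type, hence equinumerous with the power set of the naturals.\<close>
  have two: "ctwo ^c natLeq =o |UNIV :: nat set set|"
    using card_of_Pow_Func[of "UNIV :: nat set"]
    by (simp add: cexp_def Field_natLeq ctwo_def Field_card_of ordIso_symmetric)
  have "ctwo ^c natLeq <o tightness (gdelta_modification (colouring_topology ?E p ?V))"
  proof (rule tightness_gdelta_modification_colouring_topology[OF p])
    show "Card_order (ctwo ^c natLeq)"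
      by (rule Card_order_cexp)
    show "\<not> countably_colourable ?E ?V"
      using less by (rule shift_not_countably_colourable)
    show "countably_colourable ?E B" if "B \<subseteq> ?V" "|B| \<le>o ctwo ^c natLeq" for B
      using shift_small_countably_colourable[OF h that(1)] that(2) two ordLeq_ordIso_trans by blast
  qed
  moreover have "t1_space (colouring_topology ?E p ?V)"
    using shift_edge_irreflexive[OF h] by (rule t1_space_colouring_topology)
  ultimately show ?thesis
    by (intro exI[of _ "colouring_topology ?E p ?V"] conjI normal_space_colouring_topology
        countably_tight_colouring_topology[OF p])
qed

end
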